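(* Let $G=\mathbb Z/3\mathbb Z\star\mathbb Z/3\mathbb Z$, with $a$ and $b$ generators of the two factors, and $\Sigma=\{a,a^2,b,b^2\}$. Let $p,q\ge0$ with $0<p+q<1$ and let $\mu$ be the probability measure on $\Sigma$ with $\mu(a)=p$, $\mu(a^2)=q$, $\mu(b)=\mu(b^2)=(1-p-q)/2$. Then the drift of the random walk $(G,\mu)$ is $$\gamma=2(1-p-q)\sqrt{\frac{p^2+q^2+pq}{p^2+q^2-2pq+3}}.$$
   Context: Random walk $(G,\mu)$: $X_0=1$, $X_{n+1}=X_n\ast x_n$ with $(x_n)$ i.i.d. of law $\mu$. $|g|$ denotes the word length of $g\in G$ with respect to $\Sigma$. The drift is the a.s. constant limit $\gamma=\lim_n|X_n|/n$. *)

theory Defs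
  imports "HOL-Probability.Probability" "HOL-Algebra.Elementary_Groups"
begin

(* The free product of two groups, realised on reduced words: lists of nontrivial elements
   taken alternately from the two factors (tagged Inl and Inr). *)

definition reduced_words ::
    "('a, 'm) monoid_scheme \<Rightarrow> ('b, 'n) monoid_scheme \<Rightarrow> ('a + 'b) list set" where
  "reduced_words G H =
     {w. set w \<subseteq> (carrier G - {\<one>\<^bsub>G\<^esub>}) <+> (carrier H - {\<one>\<^bsub>H\<^esub>}) \<and>
         successively (\<lambda>s t. isl s \<noteq> isl t) w}"

(* Left multiplication of a reduced word by one nontrivial letter. *)
fun letter_mult ::
    "('a, 'm) monoid_scheme \<Rightarrow> ('b, 'n) monoid_scheme \<Rightarrow> 'a + 'b \<Rightarrow> ('a + 'b) list \<Rightarrow> ('a + 'b) list"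
  where
  "letter_mult G H (Inl x) (Inl y # w) =
     (if x \<otimes>\<^bsub>G\<^esub> y = \<one>\<^bsub>G\<^esub> then w else Inl (x \<otimes>\<^bsub>G\<^esub> y) # w)"
| "letter_mult G H (Inr x) (Inr y # w) =
     (if x \<otimes>\<^bsub>H\<^esub> y = \<one>\<^bsub>H\<^esub> then w else Inr (x \<otimes>\<^bsub>H\<^esub> y) # w)"
| "letter_mult G H s w = s # w"

definition free_product ::
    "('a, 'm) monoid_scheme \<Rightarrow> ('b, 'n) monoid_scheme \<Rightarrow> ('a + 'b) list monoid" where
  "free_product G H =
     \<lparr>carrier = reduced_words G H, mult = foldr (letter_mult G H), one = []\<rparr>"

definition free_product_inl :: "('a, 'm) monoid_scheme \<Rightarrow> 'a \<Rightarrow> ('a + 'b) list" where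
  "free_product_inl G x = (if x = \<one>\<^bsub>G\<^esub> then [] else [Inl x])"

definition free_product_inr :: "('b, 'n) monoid_scheme \<Rightarrow> 'b \<Rightarrow> ('a + 'b) list" where
  "free_product_inr H y = (if y = \<one>\<^bsub>H\<^esub> then [] else [Inr y])"

lemma free_product_inl_hom:
  "group G \<Longrightarrow> free_product_inl G \<in> hom G (free_product G H)"
  by (auto simp: hom_def free_product_def free_product_inl_def reduced_words_def
      group.is_monoid monoid.m_closed split: if_splits)

lemma free_product_inr_hom:
  "group H \<Longrightarrow> free_product_inr H \<in> hom H (free_product G H)"
  by (auto simp: hom_def free_product_def free_product_inr_def reduced_words_def
      group.is_monoid monoid.m_closed split: if_splits)

lemma letter_mult_closed:
  assumes "group G" "group H"
    and "s \<in> (carrier G - {\<one>\<^bsub>G\<^esub>}) <+> (carrier H - {\<one>\<^bsub>H\<^esub>})" "w \<in> reduced_words G H"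
  shows "letter_mult G H s w \<in> reduced_words G H"
proof -
  interpret G: group G by fact
  interpret H: group H by fact
  show ?thesis
    using assms(3,4)
    by (cases "(G, H, s, w)" rule: letter_mult.cases)
       (auto simp: reduced_words_def successively_Cons hd_append split: if_splits sum.splits)
qed

lemma letter_mult_letter_mult:
  assumes "group G" "group H"
    and s: "s \<in> (carrier G - {\<one>\<^bsub>G\<^esub>}) <+> (carrier H - {\<one>\<^bsub>H\<^esub>})"
    and t: "t \<in> (carrier G - {\<one>\<^bsub>G\<^esub>}) <+> (carrier H - {\<one>\<^bsub>H\<^esub>})"
    and st: "isl s = isl t" and w: "w \<in> reduced_words G H"
  shows "letter_mult G H s (letter_mult G H t w) =
    foldr (letter_mult G H) (letter_mult G H s [t]) w"
proof -
  interpret G: group G by fact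
  interpret H: group H by fact
  have G2: "x \<otimes>\<^bsub>G\<^esub> (y \<otimes>\<^bsub>G\<^esub> z) = z"
    if "x \<otimes>\<^bsub>G\<^esub> y = \<one>\<^bsub>G\<^esub>" "x \<in> carrier G" "y \<in> carrier G" "z \<in> carrier G" for x y z
    using that by (metis G.m_assoc G.l_one)
  have H2: "x \<otimes>\<^bsub>H\<^esub> (y \<otimes>\<^bsub>H\<^esub> z) = z"
    if "x \<otimes>\<^bsub>H\<^esub> y = \<one>\<^bsub>H\<^esub>" "x \<in> carrier H" "y \<in> carrier H" "z \<in> carrier H" for x y z
    using that by (metis H.m_assoc H.l_one)
  have G3: "x \<otimes>\<^bsub>G\<^esub> y \<otimes>\<^bsub>G\<^esub> z = x"
    if "y \<otimes>\<^bsub>G\<^esub> z = \<one>\<^bsub>G\<^esub>" "x \<in> carrier G" "y \<in> carrier G" "z \<in> carrier G" for x y z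
    using that by (metis G.m_assoc G.r_one)
  have H3: "x \<otimes>\<^bsub>H\<^esub> y \<otimes>\<^bsub>H\<^esub> z = x"
    if "y \<otimes>\<^bsub>H\<^esub> z = \<one>\<^bsub>H\<^esub>" "x \<in> carrier H" "y \<in> carrier H" "z \<in> carrier H" for x y z
    using that by (metis H.m_assoc H.r_one)
  show ?thesis
  proof (cases w)
    case Nil
    then show ?thesis using s t st by (cases s; cases t) auto
  next
    case (Cons u v)
    have v: "v = [] \<or> isl u \<noteq> isl (hd v)"
      using w Cons by (auto simp: reduced_words_def successively_Cons)
    have u: "u \<in> (carrier G - {\<one>\<^bsub>G\<^esub>}) <+> (carrier H - {\<one>\<^bsub>H\<^esub>})"
      using w Cons by (auto simp: reduced_words_def)
    have vl: "letter_mult G H (Inl x) v = Inl x # v" if "isl u" for x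
      using v that by (cases v; cases "hd v") auto
    have vr: "letter_mult G H (Inr x) v = Inr x # v" if "\<not> isl u" for x
      using v that by (cases v; cases "hd v") auto
    consider (G) x y where "s = Inl x" "t = Inl y" | (H) x y where "s = Inr x" "t = Inr y"
      using st by (cases s; cases t) auto
    then show ?thesis
    proof cases
      case G
      have xy: "x \<in> carrier G" "y \<in> carrier G" "x \<noteq> \<one>\<^bsub>G\<^esub>"
        using s t G by auto
      show ?thesis
      proof (cases u)
        case (Inl z)
        have z: "z \<in> carrier G" "z \<noteq> \<one>\<^bsub>G\<^esub>" using u Inl by auto
        show ?thesis
          using xy z vl Inl G2[of x y z] G3[of y z x] G.m_assoc[of x y z]
          unfolding Cons G by (cases "y \<otimes>\<^bsub>G\<^esub> z = \<one>\<^bsub>G\<^esub>"; cases "x \<otimes>\<^bsub>G\<^esub> y = \<one>\<^bsub>G\<^esub>") simp_all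
      qed (simp add: Cons G)
    next
      case H
      have xy: "x \<in> carrier H" "y \<in> carrier H" "x \<noteq> \<one>\<^bsub>H\<^esub>"
        using s t H by auto
      show ?thesis
      proof (cases u)
        case (Inr z)
        have z: "z \<in> carrier H" "z \<noteq> \<one>\<^bsub>H\<^esub>" using u Inr by auto
        show ?thesis
          using xy z vr Inr H2[of x y z] H3[of y z x] H.m_assoc[of x y z]
          unfolding Cons H by (cases "y \<otimes>\<^bsub>H\<^esub> z = \<one>\<^bsub>H\<^esub>"; cases "x \<otimes>\<^bsub>H\<^esub> y = \<one>\<^bsub>H\<^esub>") simp_all
      qed (simp add: Cons H)
    qed
  qed
qed

theorem free_product_group:
  assumes "group G" "group H"
  shows "group (free_product G H)"
proof -
  interpret G: group G by fact
  interpret H: group H by fact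
  let ?R = "reduced_words G H"
  let ?L = "(carrier G - {\<one>\<^bsub>G\<^esub>}) <+> (carrier H - {\<one>\<^bsub>H\<^esub>})"
  let ?m = "letter_mult G H"
  have tl: "s \<in> ?L" "w \<in> ?R" if "s # w \<in> ?R" for s w
    using that by (auto simp: reduced_words_def successively_Cons)
  have clo: "foldr ?m u v \<in> ?R" if "set u \<subseteq> ?L" "v \<in> ?R" for u v
    using that by (induction u) (auto intro!: letter_mult_closed assms)
  have sub: "set u \<subseteq> ?L" if "u \<in> ?R" for u
    using that by (auto simp: reduced_words_def)
  have step: "foldr ?m (?m s v) w = ?m s (foldr ?m v w)"
    if s: "s \<in> ?L" and v: "v \<in> ?R" and w: "w \<in> ?R" for s v w
  proof (cases v)
    case (Cons t v')
    note t = tl[OF v[unfolded Cons]]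
    have z: "foldr ?m v' w \<in> ?R" using clo[OF sub] t w by blast
    show ?thesis
    proof (cases "isl s = isl t")
      case True
      from letter_mult_letter_mult[OF assms s t(1) True z] True show ?thesis
        unfolding Cons by (cases s; cases t) auto
    next
      case False
      then show ?thesis unfolding Cons by (cases s; cases t) auto
    qed
  qed simp
  have assoc: "foldr ?m (foldr ?m u v) w = foldr ?m u (foldr ?m v w)"
    if "set u \<subseteq> ?L" "v \<in> ?R" "w \<in> ?R" for u v w
    using that by (induction u) (simp_all add: step clo)
  have inv1: "\<exists>t\<in>?L. ?m t [s] = []" if "s \<in> ?L" for s
    using that
  proof (elim PlusE)
    fix x assume "x \<in> carrier G - {\<one>\<^bsub>G\<^esub>}" "s = Inl x"
    then show ?thesis by (intro bexI[of _ "Inl (inv\<^bsub>G\<^esub> x)"]) auto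
  next
    fix x assume "x \<in> carrier H - {\<one>\<^bsub>H\<^esub>}" "s = Inr x"
    then show ?thesis by (intro bexI[of _ "Inr (inv\<^bsub>H\<^esub> x)"]) auto
  qed
  have single: "[s] \<in> ?R" if "s \<in> ?L" for s
    using that by (auto simp: reduced_words_def)
  have nil: "[] \<in> ?R" by (simp add: reduced_words_def)
  have cons: "?m s u = s # u" if "s # u \<in> ?R" for s u
    using that by (cases u; cases s; cases "hd u") (auto simp: reduced_words_def)
  have inv: "\<exists>v\<in>?R. foldr ?m v u = []" if "u \<in> ?R" for u
    using that
  proof (induction u)
    case (Cons s u)
    note su = tl[OF Cons.prems]
    obtain v where v: "v \<in> ?R" "foldr ?m v u = []" using Cons.IH su by blast
    obtain t where t: "t \<in> ?L" "?m t [s] = []" using inv1 su by blast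
    have "?m t (s # u) = u"
      using step[OF t(1) single[OF su(1)] su(2)] cons[OF Cons.prems] t by simp
    then have "foldr ?m (foldr ?m v [t]) (s # u) = []"
      using assoc[OF sub[OF v(1)] single[OF t(1)] Cons.prems] v by simp
    then show ?case using clo[OF sub[OF v(1)] single[OF t(1)]] by blast
  qed (use nil in \<open>auto intro: bexI[of _ "[]"]\<close>)
  show ?thesis
  proof (rule groupI)
    fix u v w
    assume "u \<in> carrier (free_product G H)" "v \<in> carrier (free_product G H)"
      "w \<in> carrier (free_product G H)"
    then show "u \<otimes>\<^bsub>free_product G H\<^esub> v \<otimes>\<^bsub>free_product G H\<^esub> w =
      u \<otimes>\<^bsub>free_product G H\<^esub> (v \<otimes>\<^bsub>free_product G H\<^esub> w)"
      using assoc[OF sub] by (simp add: free_product_def)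
  next
    fix u v
    assume "u \<in> carrier (free_product G H)" "v \<in> carrier (free_product G H)"
    then show "u \<otimes>\<^bsub>free_product G H\<^esub> v \<in> carrier (free_product G H)"
      using clo[OF sub] by (simp add: free_product_def)
  next
    fix u
    assume "u \<in> carrier (free_product G H)"
    then show "\<exists>v\<in>carrier (free_product G H). v \<otimes>\<^bsub>free_product G H\<^esub> u = \<one>\<^bsub>free_product G H\<^esub>"
      using inv by (simp add: free_product_def)
  qed (simp_all add: free_product_def nil)
qed

(* The generating sets considered here are closed under inverses, so only products
   of elements of S itself are used. *)
definition word_length :: "('g, 'm) monoid_scheme \<Rightarrow> 'g set \<Rightarrow> 'g \<Rightarrow> nat" where
  "word_length G S g =
     (LEAST n. \<exists>w. length w = n \<and> set w \<subseteq> S \<and> foldr (\<otimes>\<^bsub>G\<^esub>) w \<one>\<^bsub>G\<^esub> = g)"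

primrec random_walk ::
    "('g, 'm) monoid_scheme \<Rightarrow> (nat \<Rightarrow> 'w \<Rightarrow> 'g) \<Rightarrow> nat \<Rightarrow> 'w \<Rightarrow> 'g" where
  "random_walk G x 0 \<omega> = \<one>\<^bsub>G\<^esub>"
| "random_walk G x (Suc n) \<omega> = random_walk G x n \<omega> \<otimes>\<^bsub>G\<^esub> x n \<omega>"

definition iid_with_law :: "'w measure \<Rightarrow> (nat \<Rightarrow> 'w \<Rightarrow> 'g) \<Rightarrow> 'g pmf \<Rightarrow> bool" where
  "iid_with_law M x \<mu> \<longleftrightarrow>
     prob_space.indep_vars M (\<lambda>_. count_space UNIV) x UNIV \<and>
     (\<forall>n. distr M (count_space UNIV) (x n) = measure_pmf \<mu>)"

definition has_drift ::
    "'w measure \<Rightarrow> ('g, 'm) monoid_scheme \<Rightarrow> 'g set \<Rightarrow> (nat \<Rightarrow> 'w \<Rightarrow> 'g) \<Rightarrow> real \<Rightarrow> bool" where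
  "has_drift M G S X \<gamma> \<longleftrightarrow>
     (AE \<omega> in M. (\<lambda>n. real (word_length G S (X n \<omega>)) / real n) \<longlonglongrightarrow> \<gamma>)"

end

theory Submission
  imports Defs
begin

text \<open>
  The word length of \<open>X\<^sub>n\<close> is the length of its reduced word, and it can be corrected by a bounded
  function \<open>c\<close> so that \<open>length X\<^sub>n + c X\<^sub>n - n \<gamma>\<close> is a martingale with bounded increments; Hoeffding's
  lemma and Borel-Cantelli then give the drift \<open>\<gamma>\<close>. The corrector is affine in the last letter,
  \<open>c (w s) = \<rho>\<^sub>s * c w + \<kappa>\<^sub>s\<close>. Comparing coefficients, \<open>\<rho>\<^sub>s\<close> satisfies the equations for the
  probability of ever hitting \<open>w\<close> from \<open>w s\<close>; the solution with \<open>\<rho>\<^sub>s < 1\<close> makes \<open>c\<close> bounded, and the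
  linear system for the \<open>\<kappa>\<^sub>s\<close> is solvable for one value of \<open>\<gamma>\<close> only. The value of \<open>c\<close> at the
  identity is chosen so that the martingale property also holds there.
\<close>

section \<open>Reduced words\<close>

text \<open>Spelling out \<open>w\<close> letter by letter attains its length, and no shorter
  product can equal \<open>w\<close> because one letter lengthens a word by at most one.\<close>

lemma word_length_free_product:
  assumes S: "S = (\<lambda>s. [s]) ` L"
    and w: "set w \<subseteq> L" "foldr (letter_mult G H) w [] = w"
  shows "word_length (free_product G H) S w = length w"
  unfolding word_length_def
proof (rule Least_equality)
  let ?e = "foldr (\<otimes>\<^bsub>free_product G H\<^esub>)"
  have "?e (map (\<lambda>s. [s]) v) [] = foldr (letter_mult G H) v []" for v
    by (induction v) (simp_all add: free_product_def)
  with w show "\<exists>ws. length ws = length w \<and> set ws \<subseteq> S \<and>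
      ?e ws \<one>\<^bsub>free_product G H\<^esub> = w"
    by (intro exI[of _ "map (\<lambda>s. [s]) w"]) (auto simp: S free_product_def)
next
  fix n
  let ?e = "foldr (\<otimes>\<^bsub>free_product G H\<^esub>)"
  assume "\<exists>ws. length ws = n \<and> set ws \<subseteq> S \<and> ?e ws \<one>\<^bsub>free_product G H\<^esub> = w"
  then obtain ws where ws: "length ws = n" "set ws \<subseteq> S" "?e ws [] = w"
    by (auto simp: free_product_def)
  have le: "length (letter_mult G H s v) \<le> Suc (length v)" for s v
    by (cases "(G, H, s, v)" rule: letter_mult.cases) auto
  have "length (?e ws []) \<le> length ws"
    using ws(2)
  proof (induction ws)
    case (Cons v ws)
    then obtain s where "v = [s]" by (auto simp: S)
    with Cons le[of s "?e ws []"] show ?case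
      by (simp add: free_product_def)
  qed simp
  with ws show "length w \<le> n" by simp
qed

abbreviation (input) "Z3 \<equiv> integer_mod_group 3"

abbreviation (input) "Z3_free_product \<equiv> free_product Z3 Z3"

abbreviation (input) "Z3_letters \<equiv> {Inl 1, Inl 2, Inr 1, Inr 2 :: int + int}"

definition Z3_words :: "(int + int) list set" where
  "Z3_words = {w. set w \<subseteq> Z3_letters \<and> successively (\<lambda>s t. isl s \<noteq> isl t) w}"

text \<open>\<open>free_product\<close> is built from left multiplication, but the walk multiplies
  on the right: this is right multiplication by one letter, which affects only the end of a word. In
  Z/3 a nontrivial element times itself is its double, and times the other nontrivial element it is
  the identity.\<close>

definition Z3_step :: "(int + int) list \<Rightarrow> int + int \<Rightarrow> (int + int) list" where
  "Z3_step w s =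
    (if w = [] \<or> isl (last w) \<noteq> isl s then w @ [s]
     else if last w = s then butlast w @ [map_sum (\<lambda>x. 2 * x mod 3) (\<lambda>x. 2 * x mod 3) s]
     else butlast w)"

lemma Z3_generator:
  assumes "\<alpha> \<in> carrier Z3" "generate Z3 {\<alpha>} = carrier Z3"
  shows "(\<alpha> = 1 \<and> (\<alpha> + \<alpha>) mod 3 = 2) \<or> (\<alpha> = 2 \<and> (\<alpha> + \<alpha>) mod 3 = 1)"
proof -
  have "generate Z3 {0} = {0}"
    using group.generate_one[of Z3] by simp
  moreover have "1 \<in> carrier Z3"
    by (simp add: carrier_integer_mod_group)
  ultimately have "\<alpha> \<noteq> 0" using assms(2) by force
  then have "\<alpha> = 1 \<or> \<alpha> = 2"
    using assms(1) by (simp add: carrier_integer_mod_group) linarith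
  then show ?thesis by auto
qed

lemma reduced_words_Z3: "reduced_words Z3 Z3 = Z3_words"
proof -
  have "carrier Z3 - {\<one>\<^bsub>Z3\<^esub>} = {1, 2}"
    by (simp add: carrier_integer_mod_group) (simp add: set_eq_iff, presburger)
  then have "(carrier Z3 - {\<one>\<^bsub>Z3\<^esub>}) <+> (carrier Z3 - {\<one>\<^bsub>Z3\<^esub>}) = Z3_letters"
    by auto
  then show ?thesis
    by (simp only: reduced_words_def Z3_words_def)
qed

lemma Z3_step_closed:
  assumes w: "w \<in> Z3_words" and s: "s \<in> Z3_letters"
  shows "Z3_step w s \<in> Z3_words"
proof (cases w rule: rev_cases)
  case Nil
  then show ?thesis
    using s by (simp add: Z3_step_def Z3_words_def)
next
  case (snoc v t)
  let ?s = "map_sum (\<lambda>x. 2 * x mod 3) (\<lambda>x. 2 * x mod 3) s"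
  have "?s \<in> Z3_letters" "isl ?s = isl s" using s by auto
  with w s show ?thesis
    unfolding snoc Z3_words_def Z3_step_def
    by (cases "isl t = isl s"; cases "t = s") (simp_all add: successively_append_iff)
qed

lemma length_Z3_step: "\<bar>real (length (Z3_step w s)) - real (length w)\<bar> \<le> 1"
  by (cases w rule: rev_cases) (simp_all add: Z3_step_def)

text \<open>Prepending letters causes no cancellation as long as the concatenation alternates. So in
  the product of \<open>w\<close> and \<open>[s]\<close> only the last letter of \<open>w\<close>
  meets \<open>s\<close>, and the rest of \<open>w\<close> is put back unchanged.\<close>

lemma
  assumes w: "w \<in> Z3_words"
  shows foldr_letter_mult_Z3: "foldr (letter_mult Z3 Z3) w [] = w"
    and mult_letter_Z3: "s \<in> Z3_letters \<Longrightarrow> w \<otimes>\<^bsub>Z3_free_product\<^esub> [s] = Z3_step w s"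
proof -
  have eval: "foldr (letter_mult Z3 Z3) v u = v @ u"
    if "successively (\<lambda>s t. isl s \<noteq> isl t) (v @ u)" for v u
    using that
  proof (induction v)
    case (Cons t v)
    then have "foldr (letter_mult Z3 Z3) v u = v @ u"
      by (auto simp: successively_Cons)
    moreover have "letter_mult Z3 Z3 t (v @ u) = t # v @ u"
      using Cons.prems by (cases "v @ u"; cases t; cases "hd (v @ u)") auto
    ultimately show ?case by simp
  qed simp
  show "foldr (letter_mult Z3 Z3) w [] = w"
    using eval[of w "[]"] w by (simp add: Z3_words_def)
  show "w \<otimes>\<^bsub>Z3_free_product\<^esub> [s] = Z3_step w s" if s: "s \<in> Z3_letters"
  proof (cases w rule: rev_cases)
    case Nil
    then show ?thesis by (simp add: Z3_step_def free_product_def)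
  next
    case (snoc v t)
    let ?s = "map_sum (\<lambda>x. 2 * x mod 3) (\<lambda>x. 2 * x mod 3) s"
    have t: "t \<in> Z3_letters"
      using w by (auto simp: snoc Z3_words_def)
    have "letter_mult Z3 Z3 t [s] =
        (if isl t \<noteq> isl s then [t, s] else if t = s then [?s] else [])"
      using s t by auto
    moreover have "foldr (letter_mult Z3 Z3) v [t, s] = v @ [t, s]" if "isl t \<noteq> isl s"
      using w that by (intro eval) (auto simp: snoc Z3_words_def successively_append_iff)
    moreover have "foldr (letter_mult Z3 Z3) v [?s] = v @ [?s]" if "t = s"
    proof -
      have "isl ?s = isl s" using s by auto
      then show ?thesis
        using w that by (intro eval) (auto simp: snoc Z3_words_def successively_append_iff)
    qed
    moreover have "foldr (letter_mult Z3 Z3) v [] = v"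
      using eval[of v "[]"] w by (simp add: snoc Z3_words_def successively_append_iff)
    ultimately show ?thesis
      by (simp add: snoc free_product_def Z3_step_def)
  qed
qed

section \<open>Random walks and martingales\<close>

text \<open>The position at time \<open>n\<close> depends only on the steps with index below
  \<open>n\<close>, and disjoint blocks of an independent family are independent.\<close>

lemma random_walk_indep_step:
  fixes x :: "nat \<Rightarrow> 'w \<Rightarrow> 'g::countable" and G :: "('g, 'm) monoid_scheme"
  assumes "prob_space M" and ind: "prob_space.indep_vars M (\<lambda>_. count_space UNIV) x UNIV"
  shows "prob_space.indep_var M (count_space UNIV) (random_walk G x n) (count_space UNIV) (x n)"
proof -
  interpret prob_space M by fact
  let ?C = "count_space UNIV :: 'g measure"
  let ?X = "\<lambda>J \<omega>. \<lambda>i\<in>J. x i \<omega>"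
  let ?W = "\<lambda>f. random_walk G (\<lambda>i f. f i) n f"
  have meas: "(\<lambda>f. random_walk G (\<lambda>i f. f i) k f) \<in> PiM {..<n} (\<lambda>_. ?C) \<rightarrow>\<^sub>M ?C"
    if "k \<le> n" for k
    using that
  proof (induction k)
    case 0
    have "random_walk G (\<lambda>i f. f i) 0 = (\<lambda>_. \<one>\<^bsub>G\<^esub>)"
      by (rule ext) simp
    then show ?case by simp
  next
    case (Suc k)
    then have walk: "(\<lambda>f. random_walk G (\<lambda>i f. f i) k f) \<in> PiM {..<n} (\<lambda>_. ?C) \<rightarrow>\<^sub>M ?C"
      and step: "(\<lambda>f. f k) \<in> PiM {..<n} (\<lambda>_. ?C) \<rightarrow>\<^sub>M ?C"
      by (auto intro: measurable_component_singleton)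
    \<comment> \<open>The map is measurable for each fixed position \<open>w\<close>; countability
      of the type of group elements lets these maps be glued.\<close>
    have "(\<lambda>f. w \<otimes>\<^bsub>G\<^esub> f k) \<in> PiM {..<n} (\<lambda>_. ?C) \<rightarrow>\<^sub>M ?C" for w
      by (rule measurable_compose[OF step]) simp
    from measurable_compose_countable[OF this walk] show ?case
      by simp
  qed
  have restr: "random_walk G (\<lambda>i f. f i) k (?X {..<n} \<omega>) = random_walk G x k \<omega>"
    if "k \<le> n" for k \<omega>
    using that by (induction k) auto
  have "indep_var (PiM {..<n} (\<lambda>_. ?C)) (?X {..<n}) (PiM {n} (\<lambda>_. ?C)) (?X {n})"
    by (rule indep_var_restrict[OF ind]) auto
  then have "indep_var ?C (?W \<circ> ?X {..<n}) ?C ((\<lambda>f. f n) \<circ> ?X {n})"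
    by (rule indep_var_compose) (auto intro: meas)
  then show ?thesis
    using restr[of n] by (simp add: o_def cong: restrict_cong)
qed

text \<open>Almost surely every step lies in the support of \<open>\<mu>\<close>. This will confine
  the walk to reduced words, where the increments of the corrected length are controlled.\<close>

lemma random_walk_AE_in:
  assumes M: "prob_space M" and iid: "iid_with_law M x \<mu>"
    and one: "\<one>\<^bsub>G\<^esub> \<in> R"
    and closed: "\<And>w s. w \<in> R \<Longrightarrow> s \<in> set_pmf \<mu> \<Longrightarrow> w \<otimes>\<^bsub>G\<^esub> s \<in> R"
  shows "AE \<omega> in M. \<forall>n. random_walk G x n \<omega> \<in> R"
proof -
  interpret prob_space M by fact
  have law: "distr M (count_space UNIV) (x n) = measure_pmf \<mu>"
    and rv [measurable]: "x n \<in> M \<rightarrow>\<^sub>M count_space UNIV" for n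
    using iid by (auto simp: iid_with_law_def indep_vars_def)
  have "AE \<omega> in M. \<forall>k. x k \<omega> \<in> set_pmf \<mu>"
  proof (subst AE_all_countable, rule)
    fix k
    have "AE s in distr M (count_space UNIV) (x k). s \<in> set_pmf \<mu>"
      unfolding law by (rule AE_pmfI)
    then show "AE \<omega> in M. x k \<omega> \<in> set_pmf \<mu>"
      by (simp add: AE_distr_iff)
  qed
  then show ?thesis
  proof eventually_elim
    case (elim \<omega>)
    show ?case
    proof
      fix n show "random_walk G x n \<omega> \<in> R"
        by (induction n) (use one closed elim in auto)
    qed
  qed
qed

text \<open>By Hoeffding's lemma the next centred increment contributes a factor of at most
  \<open>exp (t\<^sup>2 * K\<^sup>2 / 2)\<close>, whatever the current position, so the bounds
  multiply along the walk.\<close>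

lemma random_walk_exp_moment:
  fixes x :: "nat \<Rightarrow> 'w \<Rightarrow> 'g::countable" and G :: "('g, 'm) monoid_scheme"
    and \<phi> :: "'g \<Rightarrow> real" and \<gamma> K t :: real
  assumes M: "prob_space M"
    and law: "\<And>n. distr M (count_space UNIV) (x n) = measure_pmf \<mu>"
    and indep: "\<And>n. prob_space.indep_var M (count_space UNIV) (random_walk G x n)
      (count_space UNIV) (x n)"
    and walk_in: "AE \<omega> in M. \<forall>n. random_walk G x n \<omega> \<in> R"
    and bounded: "\<And>w s. w \<in> R \<Longrightarrow> s \<in> set_pmf \<mu> \<Longrightarrow> \<bar>\<phi> (w \<otimes>\<^bsub>G\<^esub> s) - \<phi> w - \<gamma>\<bar> \<le> K"
    and mean: "\<And>w. w \<in> R \<Longrightarrow> measure_pmf.expectation \<mu> (\<lambda>s. \<phi> (w \<otimes>\<^bsub>G\<^esub> s) - \<phi> w - \<gamma>) = 0"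
    and t: "t > 0"
  shows "(\<integral>\<^sup>+\<omega>. exp (t * (\<phi> (random_walk G x n \<omega>) - \<phi> \<one>\<^bsub>G\<^esub> - n * \<gamma>)) \<partial>M)
    \<le> exp (n * (t\<^sup>2 * K\<^sup>2 / 2))"
proof (induction n)
  case 0
  show ?case by (simp add: prob_space.emeasure_space_1[OF M])
next
  case (Suc n)
  interpret prob_space M by fact
  let ?C = "count_space UNIV :: 'g measure"
  let ?e = "\<lambda>n w. exp (t * (\<phi> w - \<phi> \<one>\<^bsub>G\<^esub> - real n * \<gamma>))"
  let ?d = "\<lambda>w s. exp (t * (\<phi> (w \<otimes>\<^bsub>G\<^esub> s) - \<phi> w - \<gamma>))"
  let ?X = "random_walk G x"
  let ?B = "exp (t\<^sup>2 * K\<^sup>2 / 2)"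
  have rv [measurable]: "x k \<in> M \<rightarrow>\<^sub>M ?C" "?X k \<in> M \<rightarrow>\<^sub>M ?C" for k
    using indep[of k] by (auto simp: indep_var_distribution_eq)
  have XR: "AE \<omega> in M. ?X n \<omega> \<in> R"
    using walk_in by eventually_elim blast
  \<comment> \<open>Hoeffding's exponent is the square of \<open>t\<close> times the interval
    length, divided by 8; the interval from \<open>-K\<close> to \<open>K\<close> has length
    \<open>2 * K\<close>.\<close>
  have hoeff: "(\<integral>\<^sup>+s. ?d w s \<partial>measure_pmf \<mu>) \<le> ?B" if w: "w \<in> R" for w
  proof -
    interpret D: interval_bounded_random_variable "measure_pmf \<mu>"
      "\<lambda>s. \<phi> (w \<otimes>\<^bsub>G\<^esub> s) - \<phi> w - \<gamma>" "-K" K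
      using bounded[OF w] by unfold_locales (fastforce simp: AE_measure_pmf_iff abs_le_iff)+
    show ?thesis
      using D.Hoeffdings_lemma_nn_integral_0[OF t mean[OF w]]
      by (simp add: power2_eq_square field_simps)
  qed
  have "(\<integral>\<^sup>+\<omega>. ?e (Suc n) (?X (Suc n) \<omega>) \<partial>M)
      = (\<integral>\<^sup>+\<omega>. (\<lambda>(w, s). ennreal (?e n w) * ennreal (?d w s)) (?X n \<omega>, x n \<omega>) \<partial>M)"
    by (intro nn_integral_cong)
       (simp add: ennreal_mult [symmetric] exp_add [symmetric] algebra_simps)
  also have "\<dots> = (\<integral>\<^sup>+z. (\<lambda>(w, s). ennreal (?e n w) * ennreal (?d w s)) z
      \<partial>distr M (?C \<Otimes>\<^sub>M ?C) (\<lambda>\<omega>. (?X n \<omega>, x n \<omega>)))"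
    by (rule nn_integral_distr [symmetric]) (simp_all add: pair_measure_countable)
  \<comment> \<open>Independence makes the joint law a product, so the step is integrated first,
    with the position fixed.\<close>
  also have "distr M (?C \<Otimes>\<^sub>M ?C) (\<lambda>\<omega>. (?X n \<omega>, x n \<omega>)) = distr M ?C (?X n) \<Otimes>\<^sub>M measure_pmf \<mu>"
    using indep[of n] law[of n] unfolding indep_var_distribution_eq by simp
  also have "(\<integral>\<^sup>+z. (\<lambda>(w, s). ennreal (?e n w) * ennreal (?d w s)) z
        \<partial>(distr M ?C (?X n) \<Otimes>\<^sub>M measure_pmf \<mu>))
      = (\<integral>\<^sup>+w. (\<integral>\<^sup>+s. ennreal (?e n w) * ennreal (?d w s) \<partial>measure_pmf \<mu>) \<partial>distr M ?C (?X n))"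
    by (subst measure_pmf.nn_integral_fst [symmetric])
       (simp_all add: pair_measure_countable cong: measurable_cong_sets)
  also have "\<dots> = (\<integral>\<^sup>+\<omega>. ennreal (?e n (?X n \<omega>)) * (\<integral>\<^sup>+s. ennreal (?d (?X n \<omega>) s) \<partial>measure_pmf \<mu>) \<partial>M)"
    by (subst nn_integral_distr) (simp_all add: nn_integral_cmult)
  also have "\<dots> \<le> (\<integral>\<^sup>+\<omega>. ennreal (?e n (?X n \<omega>)) * ennreal ?B \<partial>M)"
    using XR by (intro nn_integral_mono_AE) (auto elim!: eventually_mono intro!: mult_left_mono hoeff)
  also have "\<dots> = (\<integral>\<^sup>+\<omega>. ennreal (?e n (?X n \<omega>)) \<partial>M) * ennreal ?B"
    by (rule nn_integral_multc) simp
  also have "\<dots> \<le> ennreal (exp (n * (t\<^sup>2 * K\<^sup>2 / 2))) * ennreal ?B"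
    by (intro mult_right_mono Suc.IH) simp
  also have "\<dots> = ennreal (exp (Suc n * (t\<^sup>2 * K\<^sup>2 / 2)))"
    by (simp add: ennreal_mult [symmetric] exp_add [symmetric] algebra_simps)
  finally show ?case .
qed

text \<open>Chernoff's inequality makes the probability of a deviation of at least
  \<open>\<epsilon> * n\<close> geometrically small, hence summable, and Borel-Cantelli applies.
  This is done for \<open>S\<close> and \<open>- S\<close>, with \<open>\<epsilon>\<close> running
  through the countably many values \<open>1 / Suc j\<close>.\<close>

lemma strong_law_of_exp_moments:
  fixes S :: "nat \<Rightarrow> 'w \<Rightarrow> real" and K :: real
  assumes "prob_space M" and K: "K > 0"
    and meas [measurable]: "\<And>n. S n \<in> borel_measurable M"
    and upper: "\<And>t n. t > 0 \<Longrightarrow>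
      (\<integral>\<^sup>+\<omega>. exp (t * S n \<omega>) \<partial>M) \<le> exp (n * (t\<^sup>2 * K\<^sup>2 / 2))"
    and lower: "\<And>t n. t > 0 \<Longrightarrow>
      (\<integral>\<^sup>+\<omega>. exp (t * - S n \<omega>) \<partial>M) \<le> exp (n * (t\<^sup>2 * K\<^sup>2 / 2))"
  shows "AE \<omega> in M. (\<lambda>n. S n \<omega> / n) \<longlonglongrightarrow> 0"
proof -
  interpret prob_space M by fact
  have ev: "AE \<omega> in M. eventually (\<lambda>n. T n \<omega> < \<epsilon> * n) sequentially"
    if \<epsilon>: "\<epsilon> > 0" and T [measurable]: "\<And>n. T n \<in> borel_measurable M"
      and exp_le: "\<And>t n. t > 0 \<Longrightarrow>
        (\<integral>\<^sup>+\<omega>. exp (t * T n \<omega>) \<partial>M) \<le> exp (n * (t\<^sup>2 * K\<^sup>2 / 2))"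
    for \<epsilon> :: real and T :: "nat \<Rightarrow> 'w \<Rightarrow> real"
  proof -
    let ?A = "\<lambda>n. {\<omega> \<in> space M. T n \<omega> \<ge> \<epsilon> * n}"
    \<comment> \<open>This \<open>t\<close> minimises the Chernoff exponent
      \<open>t\<^sup>2 * K\<^sup>2 / 2 - t * \<epsilon>\<close>.\<close>
    define t where "t = \<epsilon> / K\<^sup>2"
    define c where "c = exp (- (\<epsilon>\<^sup>2 / (2 * K\<^sup>2)))"
    have t: "t > 0" using K \<epsilon> by (simp add: t_def)
    have prob: "prob (?A n) \<le> c ^ n" for n
    proof -
      have "emeasure M (?A n) \<le> ennreal (exp (- t * (\<epsilon> * n))) *
          (\<integral>\<^sup>+\<omega>. ennreal (exp (t * T n \<omega>)) * indicator (space M) \<omega> \<partial>M)"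
        by (rule Chernoff_ineq_nn_integral_ge) (use t in auto)
      also have "(\<integral>\<^sup>+\<omega>. ennreal (exp (t * T n \<omega>)) * indicator (space M) \<omega> \<partial>M)
        = (\<integral>\<^sup>+\<omega>. ennreal (exp (t * T n \<omega>)) \<partial>M)"
        by (intro nn_integral_cong) simp
      also have "ennreal (exp (- t * (\<epsilon> * n))) * (\<integral>\<^sup>+\<omega>. ennreal (exp (t * T n \<omega>)) \<partial>M)
        \<le> ennreal (exp (- t * (\<epsilon> * n))) * ennreal (exp (n * (t\<^sup>2 * K\<^sup>2 / 2)))"
        by (intro mult_left_mono exp_le t) auto
      also have "\<dots> = ennreal (exp (n * (t\<^sup>2 * K\<^sup>2 / 2 - t * \<epsilon>)))"
        by (simp add: ennreal_mult [symmetric] exp_add [symmetric] algebra_simps)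
      also have "t\<^sup>2 * K\<^sup>2 / 2 - t * \<epsilon> = - (\<epsilon>\<^sup>2 / (2 * K\<^sup>2))"
        using K by (simp add: t_def field_simps power2_eq_square)
      also have "exp (n * (- (\<epsilon>\<^sup>2 / (2 * K\<^sup>2)))) = c ^ n"
        unfolding c_def by (rule exp_of_nat_mult)
      finally show ?thesis
        by (simp add: emeasure_eq_measure c_def)
    qed
    have c: "norm c < 1" using K \<epsilon> by (simp add: c_def)
    have "summable (\<lambda>n. prob (?A n))"
      by (rule summable_comparison_test[OF _ summable_geometric[OF c]]) (auto intro: prob)
    then have "AE \<omega> in M. eventually (\<lambda>n. \<omega> \<in> space M - ?A n) sequentially"
      by (intro borel_cantelli_AE1) (auto simp: less_top [symmetric])
    then show ?thesis
      by eventually_elim (auto elim!: eventually_mono)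
  qed
  have "AE \<omega> in M. \<forall>j. eventually (\<lambda>n. S n \<omega> < (1 / Suc j) * n) sequentially"
    unfolding AE_all_countable by (intro allI ev upper) auto
  moreover have "AE \<omega> in M. \<forall>j. eventually (\<lambda>n. - S n \<omega> < (1 / Suc j) * n) sequentially"
    unfolding AE_all_countable by (intro allI ev lower) auto
  ultimately show ?thesis
  proof eventually_elim
    case (elim \<omega>)
    show ?case
    proof (rule LIMSEQ_I)
      fix e :: real assume "e > 0"
      then obtain j where j: "1 / Suc j < e"
        using nat_approx_posE by blast
      have "eventually (\<lambda>n. norm (S n \<omega> / n - 0) < e) sequentially"
        using elim(1)[rule_format, of j] elim(2)[rule_format, of j] eventually_gt_at_top[of 0]
      proof eventually_elim
        case (elim n)
        then have "\<bar>S n \<omega>\<bar> < (1 / Suc j) * n" by linarith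
        then have "\<bar>S n \<omega>\<bar> / n < 1 / Suc j" using elim(3) by (simp add: field_simps)
        then show ?case using j by simp
      qed
      then show "\<exists>N. \<forall>n\<ge>N. norm (S n \<omega> / n - 0) < e"
        by (simp add: eventually_sequentially)
    qed
  qed
qed

section \<open>The equations for the corrector\<close>

text \<open>
  The factors \<open>u, v, y\<close> belong to the last letters \<open>a, a\<^sup>2\<close> and \<open>b\<^sup>\<plusminus>\<^sup>1\<close>, the constants \<open>\<kappa>, \<eta>\<close> to
  \<open>a, a\<^sup>2\<close>, and \<open>c\<close> is the value at the identity. Adding a constant to the corrector
  allows the constant for \<open>b\<^sup>\<plusminus>\<^sup>1\<close> to be \<open>0\<close>.
\<close>
lemma corrector_exists:
  fixes p q :: real
  assumes "p \<ge> 0" "q \<ge> 0" "0 < p + q" "p + q < 1"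
  defines "r \<equiv> (1 - p - q) / 2"
    and "\<gamma> \<equiv> 2 * (1 - p - q) * sqrt ((p\<^sup>2 + q\<^sup>2 + p * q) / (p\<^sup>2 + q\<^sup>2 - 2 * p * q + 3))"
  obtains u v y \<kappa> \<eta> c where
    "0 \<le> u" "u < 1" "0 \<le> v" "v < 1" "0 \<le> y" "y < 1"
    "q + p * v + 2 * r * (y * u) = u"
    "p + q * u + 2 * r * (y * v) = v"
    "r + r * y + p * (u * y) + q * (v * y) = y"
    "- q + p * \<eta> + 2 * r * (1 + y * \<kappa>) = \<kappa> + \<gamma>"
    "- p + q * \<kappa> + 2 * r * (1 + y * \<eta>) = \<eta> + \<gamma>"
    "- r + p * (1 + \<kappa>) + q * (1 + \<eta>) = \<gamma>"
    "p * (1 + (u * c + \<kappa>)) + q * (1 + (v * c + \<eta>)) + 2 * r * (1 + y * c) = c + \<gamma>"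
proof -
  define m where "m = p + q"
  define s where "s = p * q"
  \<comment> \<open>\<open>N\<close> and \<open>S\<close> are the numerator and the denominator
    under the root in \<open>\<gamma>\<close>, so that
    \<open>\<gamma> = 2 * (1 - m) * D / S\<close>.\<close>
  define N where "N = m\<^sup>2 - s"
  define S where "S = m\<^sup>2 - 4 * s + 3"
  define D where "D = sqrt (N * S)"
  \<comment> \<open>With \<open>k = 1 - 2 r y\<close>, eliminating \<open>u\<close> and \<open>v\<close> leaves a cubic for \<open>k\<close> that has the root \<open>m\<close>
    (the trivial solution \<open>u = v = y = 1\<close>); \<open>k\<close> is the larger root of the remaining quadratic.\<close>
  define k where "k = (m - m\<^sup>2 + 2 * s + D) / (1 + m)"
  \<comment> \<open>The determinant of the linear systems for \<open>u, v\<close> and for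
    \<open>\<kappa>, \<eta>\<close>, both with rows \<open>(k, -p)\<close> and
    \<open>(-q, k)\<close>; they are solved below by Cramer's rule.\<close>
  define E where "E = k\<^sup>2 - s"
  have m: "0 < m" "m < 1" and s: "0 \<le> s" using assms by (auto simp: m_def s_def)
  have r: "2 * r = 1 - m" by (simp add: r_def m_def)
  have N_alt: "N = p\<^sup>2 + q\<^sup>2 + p * q" and S_alt: "S = p\<^sup>2 + q\<^sup>2 - 2 * p * q + 3"
    by (simp_all add: N_def S_def m_def s_def power2_eq_square algebra_simps)
  have s4: "4 * s \<le> m\<^sup>2"
    using zero_le_power2[of "p - q"] by (simp add: m_def s_def power2_eq_square algebra_simps)
  have m2: "0 < m\<^sup>2" "m\<^sup>2 < 1" using m by (auto simp: power_less_one_iff)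
  have N: "0 < N" using s4 m2 s unfolding N_def by linarith
  have S: "3 \<le> S" using s4 by (simp add: S_def)
  have D2: "D\<^sup>2 = N * S" and D: "D \<ge> 0" using N S by (simp_all add: D_def)
  have kD: "D = (1 + m) * k - (m - m\<^sup>2 + 2 * s)" using m by (simp add: k_def)
  have quad: "(1 + m) * k\<^sup>2 = (2 * m - 2 * m\<^sup>2 + 4 * s) * k + (2 * m\<^sup>2 - 3 * s - m * s)"
  proof -
    have "(1 + m) * ((1 + m) * k\<^sup>2 - (2 * m - 2 * m\<^sup>2 + 4 * s) * k - (2 * m\<^sup>2 - 3 * s - m * s)) = D\<^sup>2 - N * S"
      unfolding kD N_def S_def by algebra
    with D2 m show ?thesis by simp
  qed
  \<comment> \<open>Clearing the denominator of \<open>k\<close> turns this into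
    \<open>2 * N < D\<close>, which reduces to \<open>m\<^sup>2 < 1\<close>. The strict inequality
    is what gives \<open>u\<close>, \<open>v\<close> and \<open>y\<close> below 1.\<close>
  have k_gt: "m < k"
  proof -
    have "(2 * N)\<^sup>2 < D\<^sup>2"
    proof -
      have "4 * N < S" using m2 by (simp add: N_def S_def)
      then have "N * (4 * N) < N * S" using N by (rule mult_strict_left_mono)
      moreover have "(2 * N)\<^sup>2 = N * (4 * N)" by (simp add: power2_eq_square)
      ultimately show ?thesis by (simp add: D2)
    qed
    then have "2 * N < D" using D by (rule power2_less_imp_less)
    then have "m * (1 + m) < m - m\<^sup>2 + 2 * s + D"
      by (simp add: N_def power2_eq_square algebra_simps)
    then show ?thesis using m by (simp add: k_def pos_less_divide_eq)
  qed
  \<comment> \<open>Equivalent to \<open>D \<le> 1 + m\<^sup>2 - 2 * s\<close>, where the difference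
    of the squares factorises; it yields \<open>0 \<le> y\<close>.\<close>
  have k_le: "k \<le> 1"
  proof -
    have "0 \<le> (1 - m\<^sup>2) * (1 - s)"
      using m2 s4 by (intro mult_nonneg_nonneg) auto
    moreover have "(1 + m\<^sup>2 - 2 * s)\<^sup>2 - N * S = (1 - m\<^sup>2) * (1 - s)"
      unfolding N_def S_def by algebra
    ultimately have "D\<^sup>2 \<le> (1 + m\<^sup>2 - 2 * s)\<^sup>2" by (simp add: D2)
    moreover have "0 \<le> 1 + m\<^sup>2 - 2 * s" using s4 m2 s by linarith
    ultimately have "D \<le> 1 + m\<^sup>2 - 2 * s" by (rule power2_le_imp_le)
    then show ?thesis using m by (simp add: k_def pos_divide_le_eq)
  qed
  have k0: "0 < k" using m k_gt by simp
  have E: "0 < E"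
  proof -
    have "m\<^sup>2 < k\<^sup>2" using k_gt m by (intro power_strict_mono) auto
    then show ?thesis using s4 s by (simp add: E_def)
  qed
  have \<gamma>: "\<gamma> = 2 * (1 - m) * D / S"
  proof -
    have "sqrt (N / S) = D / S"
      using S by (simp add: D_def real_sqrt_divide real_sqrt_mult field_simps)
    then show ?thesis
      unfolding \<gamma>_def N_alt [symmetric] S_alt [symmetric] by (simp add: m_def diff_diff_eq)
  qed
  define y where "y = (1 - k) / (1 - m)"
  define u where "u = (q * k + p\<^sup>2) / E"
  define v where "v = (p * k + q\<^sup>2) / E"
  define \<kappa> where "\<kappa> = (k * (1 - m - q - \<gamma>) + p * (1 - m - p - \<gamma>)) / E"
  define \<eta> where "\<eta> = (k * (1 - m - p - \<gamma>) + q * (1 - m - q - \<gamma>)) / E"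
  have ry: "2 * r * y = 1 - k" using m by (simp add: r y_def)
  have uE: "u * E = q * k + p\<^sup>2" and vE: "v * E = p * k + q\<^sup>2"
    and \<kappa>E: "\<kappa> * E = k * (1 - m - q - \<gamma>) + p * (1 - m - p - \<gamma>)"
    and \<eta>E: "\<eta> * E = k * (1 - m - p - \<gamma>) + q * (1 - m - q - \<gamma>)"
    using E by (simp_all add: u_def v_def \<kappa>_def \<eta>_def)
  have cancel: "a = b" if "E * (a - b) = 0" for a b using that E by simp
  have ku: "k * u = q + p * v"
    by (rule cancel) (use uE vE in \<open>unfold E_def s_def, algebra\<close>)
  have kv: "k * v = p + q * u"
    by (rule cancel) (use uE vE in \<open>unfold E_def s_def, algebra\<close>)
  have k\<kappa>: "k * \<kappa> = p * \<eta> + 1 - m - q - \<gamma>"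
    by (rule cancel) (use \<kappa>E \<eta>E in \<open>unfold E_def s_def, algebra\<close>)
  have k\<eta>: "k * \<eta> = q * \<kappa> + 1 - m - p - \<gamma>"
    by (rule cancel) (use \<kappa>E \<eta>E in \<open>unfold E_def s_def, algebra\<close>)
  have \<gamma>S: "\<gamma> * S = 2 * (1 - m) * D" using S by (simp add: \<gamma>)
  \<comment> \<open>Twice the constant equation for a last letter from the second factor. The
    systems for \<open>\<kappa>, \<eta>\<close> are solvable for every \<open>\<gamma>\<close>; this
    equation is where its actual value enters.\<close>
  have third: "2 * (p * \<kappa> + q * \<eta>) = 2 * \<gamma> + 1 - 3 * m"
  proof -
    have "S * (E * (2 * (p * \<kappa> + q * \<eta>) - (2 * \<gamma> + 1 - 3 * m))) = 0"
      using \<kappa>E \<eta>E \<gamma>S quad unfolding E_def S_def kD m_def s_def by algebra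
    then show ?thesis using E S by simp
  qed
  \<comment> \<open>Twice the equation for \<open>y\<close>. With denominators cleared it is the
    cubic for \<open>k\<close>, of which \<open>quad\<close> is the nontrivial factor.\<close>
  have yeq: "y * (1 + m - 2 * (p * u + q * v)) = 1 - m"
  proof -
    have "E * ((1 - k) * (1 + m - 2 * (p * u + q * v)) - (1 - m)\<^sup>2) = 0"
      using uE vE quad unfolding E_def m_def s_def by algebra
    then have "(1 - k) * (1 + m - 2 * (p * u + q * v)) = (1 - m)\<^sup>2" using E by simp
    then show ?thesis using m by (simp add: y_def power2_eq_square)
  qed
  have bounds: "0 \<le> u" "0 \<le> v" "0 \<le> y" "y < 1"
    using assms E k0 k_le k_gt m by (simp_all add: u_def v_def y_def)
  \<comment> \<open>These products are \<open>E * (1 - u)\<close> and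
    \<open>E * (1 - v)\<close>.\<close>
  have "0 < (k - m) * (k + p)" "0 < (k - m) * (k + q)"
    using k_gt k0 assms by simp_all
  then have bounds': "u < 1" "v < 1"
    using E by (simp_all add: u_def v_def E_def m_def s_def power2_eq_square algebra_simps)
  \<comment> \<open>The equation at the identity is linear in \<open>c\<close>, with coefficient
    \<open>Q\<close> after collecting terms; \<open>Q\<close> is positive because
    \<open>p + q + 2 * r = 1\<close> and \<open>y < 1\<close>.\<close>
  define Q where "Q = 1 - p * u - q * v - 2 * r * y"
  define c where "c = (p * (1 + \<kappa>) + q * (1 + \<eta>) + 2 * r - \<gamma>) / Q"
  have "Q > 0"
  proof -
    have "p * u \<le> p" "q * v \<le> q" "2 * r * y < 2 * r"
      using bounds bounds' assms r m by (simp_all add: mult_left_le)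
    then show ?thesis using r by (simp add: Q_def m_def)
  qed
  then have c: "c * Q = p * (1 + \<kappa>) + q * (1 + \<eta>) + 2 * r - \<gamma>"
    by (simp add: c_def)
  show thesis
  proof (rule that[of u v y \<eta> \<kappa> c])
    show "q + p * v + 2 * r * (y * u) = u"
      using ku ry by algebra
    show "p + q * u + 2 * r * (y * v) = v"
      using kv ry by algebra
    show "r + r * y + p * (u * y) + q * (v * y) = y"
      using yeq r by algebra
    show "- q + p * \<eta> + 2 * r * (1 + y * \<kappa>) = \<kappa> + \<gamma>"
      using k\<kappa> ry r by algebra
    show "- p + q * \<kappa> + 2 * r * (1 + y * \<eta>) = \<eta> + \<gamma>"
      using k\<eta> ry r by algebra
    show "- r + p * (1 + \<kappa>) + q * (1 + \<eta>) = \<gamma>"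
      using third r m_def by algebra
    show "p * (1 + (u * c + \<kappa>)) + q * (1 + (v * c + \<eta>)) + 2 * r * (1 + y * c) = c + \<gamma>"
      using c by (simp add: Q_def algebra_simps)
  qed (use bounds bounds' in simp_all)
qed

section \<open>The drift\<close>

text \<open>If \<open>z\<close> is the corrector of a word without its last letter, the mean
  equation is affine in \<open>z\<close>: the first three equations match the coefficients of
  \<open>z\<close>, the next three the constants, and the seventh treats the empty word.\<close>

lemma corrected_length:
  fixes p q r u v y \<kappa> \<eta> c \<gamma> :: real
  assumes bounds: "0 \<le> u" "u < 1" "0 \<le> v" "v < 1" "0 \<le> y" "y < 1"
    and eqs: "q + p * v + 2 * r * (y * u) = u"
    "p + q * u + 2 * r * (y * v) = v"
    "r + r * y + p * (u * y) + q * (v * y) = y"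
    "- q + p * \<eta> + 2 * r * (1 + y * \<kappa>) = \<kappa> + \<gamma>"
    "- p + q * \<kappa> + 2 * r * (1 + y * \<eta>) = \<eta> + \<gamma>"
    "- r + p * (1 + \<kappa>) + q * (1 + \<eta>) = \<gamma>"
    "p * (1 + (u * c + \<kappa>)) + q * (1 + (v * c + \<eta>)) + 2 * r * (1 + y * c) = c + \<gamma>"
    and r: "2 * r = 1 - p - q"
    and \<alpha>: "(\<alpha> = 1 \<and> \<alpha>' = 2) \<or> (\<alpha> = 2 \<and> \<alpha>' = 1)"
    and \<beta>: "(\<beta> = 1 \<and> \<beta>' = 2) \<or> (\<beta> = 2 \<and> \<beta>' = 1)"
  obtains \<phi> :: "(int + int) list \<Rightarrow> real" and C :: real
  where "\<And>w. \<bar>\<phi> w - length w\<bar> \<le> C"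
    and "\<And>w. w \<in> Z3_words \<Longrightarrow>
      p * \<phi> (Z3_step w (Inl \<alpha>)) + q * \<phi> (Z3_step w (Inl \<alpha>')) +
      r * \<phi> (Z3_step w (Inr \<beta>)) + r * \<phi> (Z3_step w (Inr \<beta>')) = \<phi> w + \<gamma>"
proof -
  define f where "f z s = (if s = Inl \<alpha> then u * z + \<kappa> else if s = Inl \<alpha>' then v * z + \<eta> else y * z)"
    for z :: real and s :: "int + int"
  define \<phi> where "\<phi> w = length w + foldl f c w" for w
  \<comment> \<open>The map taking \<open>z\<close> to \<open>t * z + d\<close> preserves the
    interval from \<open>-C\<close> to \<open>C\<close> once
    \<open>\<bar>d\<bar> \<le> C * (1 - t)\<close>. The summands ensure this for every letter and
    include the initial value \<open>c\<close>.\<close>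
  define C where "C = \<bar>c\<bar> + \<bar>\<kappa>\<bar> / (1 - u) + \<bar>\<eta>\<bar> / (1 - v)"
  have C: "\<bar>c\<bar> \<le> C" "\<bar>\<kappa>\<bar> / (1 - u) \<le> C" "\<bar>\<eta>\<bar> / (1 - v) \<le> C" "0 \<le> C"
    using bounds by (simp_all add: C_def)
  have contract: "\<bar>t * z + d\<bar> \<le> C" if "\<bar>z\<bar> \<le> C" "0 \<le> t" "t < 1" "\<bar>d\<bar> / (1 - t) \<le> C" for t z d
  proof -
    have "\<bar>t * z\<bar> \<le> t * C" using that by (simp add: abs_mult mult_left_mono)
    moreover have "\<bar>d\<bar> \<le> C * (1 - t)" using that by (simp add: pos_divide_le_eq)
    ultimately show ?thesis by (simp add: algebra_simps)
  qed
  have f_bound: "\<bar>f z s\<bar> \<le> C" if "\<bar>z\<bar> \<le> C" for z s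
  proof -
    note contract[OF that bounds(1,2) C(2)] contract[OF that bounds(3,4) C(3)]
    moreover have "\<bar>y * z\<bar> \<le> C"
      using contract[OF that bounds(5,6), of 0] C(4) by simp
    ultimately show ?thesis by (simp add: f_def)
  qed
  have "\<bar>foldl f c w\<bar> \<le> C" for w
    by (induction w rule: rev_induct) (simp_all add: C f_bound)
  then have "\<bar>\<phi> w - length w\<bar> \<le> C" for w by (simp add: \<phi>_def)
  moreover have "p * \<phi> (Z3_step w (Inl \<alpha>)) + q * \<phi> (Z3_step w (Inl \<alpha>')) +
      r * \<phi> (Z3_step w (Inr \<beta>)) + r * \<phi> (Z3_step w (Inr \<beta>')) = \<phi> w + \<gamma>"
    if w: "w \<in> Z3_words" for w
  proof (cases w rule: rev_cases)
    case Nil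
    have "\<alpha> \<noteq> \<alpha>'" using \<alpha> by auto
    then show ?thesis
      using eqs(7) by (simp add: Nil Z3_step_def \<phi>_def f_def algebra_simps)
  next
    case (snoc v' t)
    define z where "z = foldl f c v'"
    define l where "l = real (length v')"
    have \<alpha>s: "\<alpha> \<noteq> \<alpha>'" "\<alpha>' \<noteq> \<alpha>" "2 * \<alpha> mod 3 = \<alpha>'" "2 * \<alpha>' mod 3 = \<alpha>"
      using \<alpha> by auto
    have \<beta>s: "\<beta> \<noteq> \<beta>'" "\<beta>' \<noteq> \<beta>" "2 * \<beta> mod 3 = \<beta>'" "2 * \<beta>' mod 3 = \<beta>"
      using \<beta> by auto
    have \<phi>: "\<phi> v' = l + z" "\<phi> (v' @ [s]) = l + 1 + f z s" "\<phi> (v' @ [s, s']) = l + 2 + f (f z s) s'" for s s'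
      by (simp_all add: \<phi>_def l_def z_def)
    have f: "f z (Inl \<alpha>) = u * z + \<kappa>" "f z (Inl \<alpha>') = v * z + \<eta>" "f z (Inr b) = y * z" for z b
      using \<alpha>s(1) by (simp_all add: f_def)
    have "t \<in> Z3_letters"
      using w by (auto simp: snoc Z3_words_def)
    then consider "t = Inl \<alpha>" | "t = Inl \<alpha>'" | "t = Inr \<beta>" | "t = Inr \<beta>'"
      using \<alpha> \<beta> by auto
    then show ?thesis
    proof cases
      case 1
      \<comment> \<open>Appending \<open>Inl \<alpha>\<close> turns the last letter into
        \<open>Inl \<alpha>'\<close>, hence \<open>v\<close> and \<open>\<eta>\<close>; appending
        \<open>Inl \<alpha>'\<close> deletes it. The multiple of \<open>l + 1\<close> below vanishes
        because the four weights add up to 1.\<close>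
      have "p * (l + 1 + (v * z + \<eta>)) + q * (l + z) + r * (l + 2 + y * (u * z + \<kappa>)) + r * (l + 2 + y * (u * z + \<kappa>))
          = l + 1 + (u * z + \<kappa>) + \<gamma>" (is "?lhs = ?rhs")
      proof -
        have "?lhs - ?rhs = z * (q + p * v + 2 * r * (y * u) - u)
            + (- q + p * \<eta> + 2 * r * (1 + y * \<kappa>) - (\<kappa> + \<gamma>)) + (l + 1) * (2 * r - (1 - p - q))"
          by (simp add: algebra_simps)
        then show ?thesis using eqs(1,4) r by simp
      qed
      then show ?thesis
        by (simp add: snoc 1 Z3_step_def \<phi> f \<alpha>s \<beta>s)
    next
      case 2
      have "p * (l + z) + q * (l + 1 + (u * z + \<kappa>)) + r * (l + 2 + y * (v * z + \<eta>)) + r * (l + 2 + y * (v * z + \<eta>))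
          = l + 1 + (v * z + \<eta>) + \<gamma>" (is "?lhs = ?rhs")
      proof -
        have "?lhs - ?rhs = z * (p + q * u + 2 * r * (y * v) - v)
            + (- p + q * \<kappa> + 2 * r * (1 + y * \<eta>) - (\<eta> + \<gamma>)) + (l + 1) * (2 * r - (1 - p - q))"
          by (simp add: algebra_simps)
        then show ?thesis using eqs(2,5) r by simp
      qed
      then show ?thesis
        by (simp add: snoc 2 Z3_step_def \<phi> f \<alpha>s \<beta>s)
    next
      case 3
      \<comment> \<open>One of the two letters from the second factor changes the last letter, the
        other deletes it. Their weights agree, so the next case leads to the same equations.\<close>
      have "p * (l + 2 + (u * (y * z) + \<kappa>)) + q * (l + 2 + (v * (y * z) + \<eta>)) + r * (l + 1 + y * z) + r * (l + z)
          = l + 1 + y * z + \<gamma>" (is "?lhs = ?rhs")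
      proof -
        have "?lhs - ?rhs = z * (r + r * y + p * (u * y) + q * (v * y) - y)
            + (- r + p * (1 + \<kappa>) + q * (1 + \<eta>) - \<gamma>) + (l + 1) * (2 * r - (1 - p - q))"
          by (simp add: algebra_simps)
        then show ?thesis using eqs(3,6) r by simp
      qed
      then show ?thesis
        by (simp add: snoc 3 Z3_step_def \<phi> f \<alpha>s \<beta>s)
    next
      case 4
      have "p * (l + 2 + (u * (y * z) + \<kappa>)) + q * (l + 2 + (v * (y * z) + \<eta>)) + r * (l + z) + r * (l + 1 + y * z)
          = l + 1 + y * z + \<gamma>" (is "?lhs = ?rhs")
      proof -
        have "?lhs - ?rhs = z * (r + r * y + p * (u * y) + q * (v * y) - y)
            + (- r + p * (1 + \<kappa>) + q * (1 + \<eta>) - \<gamma>) + (l + 1) * (2 * r - (1 - p - q))"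
          by (simp add: algebra_simps)
        then show ?thesis using eqs(3,6) r by simp
      qed
      then show ?thesis
        by (simp add: snoc 4 Z3_step_def \<phi> f \<alpha>s \<beta>s)
    qed
  qed
  ultimately show thesis by (rule that)
qed

theorem mainTheorem10:
  fixes G :: "(int + int) list monoid"
    and \<alpha> \<beta> :: int
    and a b :: "(int + int) list"
    and \<Sigma> :: "(int + int) list set"
    and p q :: real
    and \<mu> :: "(int + int) list pmf"
    and M :: "'w measure"
    and x :: "nat \<Rightarrow> 'w \<Rightarrow> (int + int) list"
  assumes "G = free_product (integer_mod_group 3) (integer_mod_group 3)"
    and "\<alpha> \<in> carrier (integer_mod_group 3)"
    and "generate (integer_mod_group 3) {\<alpha>} = carrier (integer_mod_group 3)"
    and "\<beta> \<in> carrier (integer_mod_group 3)"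
    and "generate (integer_mod_group 3) {\<beta>} = carrier (integer_mod_group 3)"
    and "a = free_product_inl (integer_mod_group 3) \<alpha>"
    and "b = free_product_inr (integer_mod_group 3) \<beta>"
    and "\<Sigma> = {a, a [^]\<^bsub>G\<^esub> (2::nat), b, b [^]\<^bsub>G\<^esub> (2::nat)}"
    and "p \<ge> 0" and "q \<ge> 0" and "0 < p + q" and "p + q < 1"
    and "set_pmf \<mu> \<subseteq> \<Sigma>"
    and "pmf \<mu> a = p" and "pmf \<mu> (a [^]\<^bsub>G\<^esub> (2::nat)) = q"
    and "pmf \<mu> b = (1 - p - q) / 2" and "pmf \<mu> (b [^]\<^bsub>G\<^esub> (2::nat)) = (1 - p - q) / 2"
    and "prob_space M" and "iid_with_law M x \<mu>"
  shows "has_drift M G \<Sigma> (random_walk G x)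
    (2 * (1 - p - q) * sqrt ((p\<^sup>2 + q\<^sup>2 + p * q) / (p\<^sup>2 + q\<^sup>2 - 2 * p * q + 3)))"
proof -
  let ?R = Z3_words
  let ?\<gamma> = "2 * (1 - p - q) * sqrt ((p\<^sup>2 + q\<^sup>2 + p * q) / (p\<^sup>2 + q\<^sup>2 - 2 * p * q + 3))"
  define \<alpha>' where "\<alpha>' = (\<alpha> + \<alpha>) mod 3"
  define \<beta>' where "\<beta>' = (\<beta> + \<beta>) mod 3"
  have \<alpha>: "(\<alpha> = 1 \<and> \<alpha>' = 2) \<or> (\<alpha> = 2 \<and> \<alpha>' = 1)"
    using Z3_generator[OF assms(2,3)] by (simp add: \<alpha>'_def)
  have \<beta>: "(\<beta> = 1 \<and> \<beta>' = 2) \<or> (\<beta> = 2 \<and> \<beta>' = 1)"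
    using Z3_generator[OF assms(4,5)] by (simp add: \<beta>'_def)
  have a: "a = [Inl \<alpha>]" and b: "b = [Inr \<beta>]"
    using \<alpha> \<beta> by (auto simp: assms(6,7) free_product_inl_def free_product_inr_def)
  have a2: "a [^]\<^bsub>G\<^esub> (2::nat) = [Inl \<alpha>']" and b2: "b [^]\<^bsub>G\<^esub> (2::nat) = [Inr \<beta>']"
    using \<alpha> \<beta> by (auto simp: a b assms(1) free_product_def nat_pow_def numeral_2_eq_2)
  have \<Sigma>: "\<Sigma> = {[Inl \<alpha>], [Inl \<alpha>'], [Inr \<beta>], [Inr \<beta>']}"
    using assms(8) by (simp only: a2 b2) (simp only: a b)
  \<comment> \<open>Whichever generators are chosen, \<open>\<Sigma>\<close> consists of all four
    letters.\<close>
  then have \<Sigma>_letters: "\<Sigma> = (\<lambda>s. [s]) ` Z3_letters"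
    using \<alpha> \<beta> by auto
  have supp: "\<exists>t\<in>Z3_letters. s = [t]" if "s \<in> set_pmf \<mu>" for s
    using that assms(13) \<Sigma>_letters by blast
  define r where "r = (1 - p - q) / 2"
  obtain u v y \<kappa> \<eta> c where
    "0 \<le> u" "u < 1" "0 \<le> v" "v < 1" "0 \<le> y" "y < 1"
    "q + p * v + 2 * r * (y * u) = u"
    "p + q * u + 2 * r * (y * v) = v"
    "r + r * y + p * (u * y) + q * (v * y) = y"
    "- q + p * \<eta> + 2 * r * (1 + y * \<kappa>) = \<kappa> + ?\<gamma>"
    "- p + q * \<kappa> + 2 * r * (1 + y * \<eta>) = \<eta> + ?\<gamma>"
    "- r + p * (1 + \<kappa>) + q * (1 + \<eta>) = ?\<gamma>"
    "p * (1 + (u * c + \<kappa>)) + q * (1 + (v * c + \<eta>)) + 2 * r * (1 + y * c) = c + ?\<gamma>"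
    unfolding r_def by (rule corrector_exists[OF assms(9-12)])
  moreover have "2 * r = 1 - p - q" by (simp add: r_def)
  ultimately obtain \<phi> :: "(int + int) list \<Rightarrow> real" and C :: real
    where \<phi>: "\<And>w. \<bar>\<phi> w - length w\<bar> \<le> C"
      and harm: "\<And>w. w \<in> ?R \<Longrightarrow>
        p * \<phi> (Z3_step w (Inl \<alpha>)) + q * \<phi> (Z3_step w (Inl \<alpha>')) +
        r * \<phi> (Z3_step w (Inr \<beta>)) + r * \<phi> (Z3_step w (Inr \<beta>')) = \<phi> w + ?\<gamma>"
    using \<alpha> \<beta> by (rule corrected_length) (rule that)
  have one: "\<one>\<^bsub>G\<^esub> \<in> ?R"
    unfolding reduced_words_Z3 [symmetric]
    by (simp add: assms(1) free_product_def reduced_words_def)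
  have step: "w \<otimes>\<^bsub>G\<^esub> [s] = Z3_step w s" if "w \<in> ?R" "s \<in> Z3_letters" for w s
    unfolding assms(1) by (rule mult_letter_Z3[OF that])
  have closed: "w \<otimes>\<^bsub>G\<^esub> s \<in> ?R" if "w \<in> ?R" "s \<in> set_pmf \<mu>" for w s
    using supp[OF that(2)] step[OF that(1)] Z3_step_closed[OF that(1)] by force
  have bounded: "\<bar>\<phi> (w \<otimes>\<^bsub>G\<^esub> s) - \<phi> w - ?\<gamma>\<bar> \<le> 1 + 2 * C + \<bar>?\<gamma>\<bar>"
    if w: "w \<in> ?R" and s: "s \<in> set_pmf \<mu>" for w s
  proof -
    obtain t where t: "t \<in> Z3_letters" "s = [t]" using supp[OF s] by blast
    have "\<bar>real (length (w \<otimes>\<^bsub>G\<^esub> s)) - real (length w)\<bar> \<le> 1"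
      unfolding t(2) step[OF w t(1)] by (rule length_Z3_step)
    with \<phi>[of "w \<otimes>\<^bsub>G\<^esub> s"] \<phi>[of w] show ?thesis by linarith
  qed
  have mean: "measure_pmf.expectation \<mu> (\<lambda>s. \<phi> (w \<otimes>\<^bsub>G\<^esub> s) - \<phi> w - ?\<gamma>) = 0" if w: "w \<in> ?R" for w
  proof -
    let ?d = "\<lambda>s. \<phi> (w \<otimes>\<^bsub>G\<^esub> s) - \<phi> w - ?\<gamma>"
    have pmf: "pmf \<mu> [Inl \<alpha>] = p" "pmf \<mu> [Inl \<alpha>'] = q"
      "pmf \<mu> [Inr \<beta>] = (1 - p - q) / 2" "pmf \<mu> [Inr \<beta>'] = (1 - p - q) / 2"
      using assms(14-17) by (simp_all only: a2 b2) (simp_all only: a b)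
    have "measure_pmf.expectation \<mu> ?d = (\<Sum>s\<in>\<Sigma>. ?d s * pmf \<mu> s)"
      using assms(13) by (intro integral_measure_pmf_real) (auto simp: \<Sigma>)
    also have "\<dots> = ?d [Inl \<alpha>] * p + ?d [Inl \<alpha>'] * q + ?d [Inr \<beta>] * ((1 - p - q) / 2)
        + ?d [Inr \<beta>'] * ((1 - p - q) / 2)"
    proof -
      have "\<alpha> \<noteq> \<alpha>'" "\<beta> \<noteq> \<beta>'" using \<alpha> \<beta> by auto
      then show ?thesis by (simp add: \<Sigma> pmf)
    qed
    also have "\<dots> = 0"
    proof -
      have "[Inl \<alpha>] \<in> \<Sigma>" "[Inl \<alpha>'] \<in> \<Sigma>" "[Inr \<beta>] \<in> \<Sigma>" "[Inr \<beta>'] \<in> \<Sigma>"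
        by (simp_all add: \<Sigma>)
      then have "Inl \<alpha> \<in> Z3_letters" "Inl \<alpha>' \<in> Z3_letters" "Inr \<beta> \<in> Z3_letters" "Inr \<beta>' \<in> Z3_letters"
        unfolding \<Sigma>_letters by blast+
      then show ?thesis
        using harm[OF w] by (simp only: step[OF w] r_def) (simp add: field_simps)
    qed
    finally show ?thesis .
  qed
  have law: "distr M (count_space UNIV) (x n) = measure_pmf \<mu>"
    and ind: "prob_space.indep_vars M (\<lambda>_. count_space UNIV) x UNIV" for n
    using assms(19) by (simp_all add: iid_with_law_def)
  have walk_in: "AE \<omega> in M. \<forall>n. random_walk G x n \<omega> \<in> ?R"
    by (rule random_walk_AE_in[OF assms(18,19) one closed])
  note exp_moment =
    random_walk_exp_moment[OF assms(18) law random_walk_indep_step[OF assms(18) ind] walk_in]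
  \<comment> \<open>Enlarged to be positive, as the Chernoff argument divides by
    \<open>K\<^sup>2\<close>.\<close>
  define K where "K = \<bar>1 + 2 * C + \<bar>?\<gamma>\<bar>\<bar> + 1"
  have K: "K > 0" by (simp add: K_def)
  have b: "\<bar>\<phi> (w \<otimes>\<^bsub>G\<^esub> s) - \<phi> w - ?\<gamma>\<bar> \<le> K"
      "\<bar>- \<phi> (w \<otimes>\<^bsub>G\<^esub> s) - - \<phi> w - - ?\<gamma>\<bar> \<le> K" if "w \<in> ?R" "s \<in> set_pmf \<mu>" for w s
    using bounded[OF that] unfolding K_def by linarith+
  \<comment> \<open>The lower tail comes from the same estimate for \<open>- \<phi>\<close>, whose
    drift is \<open>- ?\<gamma>\<close>.\<close>
  have mean': "measure_pmf.expectation \<mu> (\<lambda>s. - \<phi> (w \<otimes>\<^bsub>G\<^esub> s) - - \<phi> w - - ?\<gamma>) = 0"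
    if "w \<in> ?R" for w
  proof -
    have "measure_pmf.expectation \<mu> (\<lambda>s. - (\<phi> (w \<otimes>\<^bsub>G\<^esub> s) - \<phi> w - ?\<gamma>)) = 0"
      using mean[OF that] by (subst Bochner_Integration.integral_minus) simp
    then show ?thesis by (simp add: algebra_simps)
  qed
  let ?S = "\<lambda>n \<omega>. \<phi> (random_walk G x n \<omega>) - \<phi> \<one>\<^bsub>G\<^esub> - real n * ?\<gamma>"
  have "AE \<omega> in M. (\<lambda>n. ?S n \<omega> / n) \<longlonglongrightarrow> 0"
  proof (rule strong_law_of_exp_moments[OF assms(18) K])
    show "?S n \<in> borel_measurable M" for n
    proof -
      have [measurable]: "random_walk G x n \<in> M \<rightarrow>\<^sub>M count_space UNIV"
        using random_walk_indep_step[OF assms(18) ind, of G n]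
        unfolding prob_space.indep_var_distribution_eq[OF assms(18)] by blast
      show ?thesis by simp
    qed
    show "(\<integral>\<^sup>+\<omega>. exp (t * ?S n \<omega>) \<partial>M) \<le> exp (n * (t\<^sup>2 * K\<^sup>2 / 2))" if "t > 0" for t n
      by (rule exp_moment[OF b(1) mean that])
    show "(\<integral>\<^sup>+\<omega>. exp (t * - ?S n \<omega>) \<partial>M) \<le> exp (n * (t\<^sup>2 * K\<^sup>2 / 2))" if "t > 0" for t n
      using exp_moment[where \<phi> = "\<lambda>w. - \<phi> w", OF b(2) mean' that, of n] by (simp add: algebra_simps)
  qed
  with walk_in show ?thesis
    unfolding has_drift_def
  proof eventually_elim
    case (elim \<omega>)
    let ?X = "\<lambda>n. random_walk G x n \<omega>"
    \<comment> \<open>The corrector is bounded by \<open>C\<close>, so it disappears after division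
      by \<open>n\<close>.\<close>
    have "(\<lambda>n. (length (?X n) - \<phi> (?X n)) / n) \<longlonglongrightarrow> 0"
    proof (rule tendsto_rabs_zero_cancel, rule tendsto_sandwich[OF _ _ tendsto_const lim_const_over_n[of C]])
      show "\<forall>\<^sub>F n in sequentially. \<bar>(length (?X n) - \<phi> (?X n)) / n\<bar> \<le> C / n"
        using \<phi> by (intro always_eventually allI) (simp add: abs_minus_commute divide_right_mono)
    qed simp
    from tendsto_add[OF tendsto_add[OF tendsto_add[OF this elim(2)]
        lim_const_over_n[of "\<phi> \<one>\<^bsub>G\<^esub>"]] tendsto_const[of ?\<gamma>]]
    have "(\<lambda>n. (length (?X n) - \<phi> (?X n)) / n + ?S n \<omega> / n + \<phi> \<one>\<^bsub>G\<^esub> / n + ?\<gamma>) \<longlonglongrightarrow> ?\<gamma>"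
      by simp
    then have "(\<lambda>n. length (?X n) / n) \<longlonglongrightarrow> ?\<gamma>"
    proof (rule Lim_transform_eventually)
      show "eventually (\<lambda>n. (length (?X n) - \<phi> (?X n)) / n + ?S n \<omega> / n + \<phi> \<one>\<^bsub>G\<^esub> / n + ?\<gamma>
          = length (?X n) / n) sequentially"
        \<comment> \<open>At \<open>n = 0\<close> all quotients are 0 and the left side is
          \<open>?\<gamma>\<close>, so \<open>n > 0\<close> is required.\<close>
        using eventually_gt_at_top[of 0] by eventually_elim (simp add: field_simps)
    qed
    moreover have "word_length G \<Sigma> (?X n) = length (?X n)" for n
      unfolding assms(1)
    proof (rule word_length_free_product[OF \<Sigma>_letters])
      have w: "random_walk (free_product Z3 Z3) x n \<omega> \<in> ?R"
        using elim(1) assms(1) by simp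
      then show "set (random_walk (free_product Z3 Z3) x n \<omega>) \<subseteq> Z3_letters"
        by (simp add: Z3_words_def)
      show "foldr (letter_mult Z3 Z3) (random_walk (free_product Z3 Z3) x n \<omega>) []
          = random_walk (free_product Z3 Z3) x n \<omega>"
        by (rule foldr_letter_mult_Z3[OF w])
    qed
    ultimately show ?case by simp
  qed
qed

end
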